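(* For every connected graph $H$, $$\operatorname{gp}(C_4\boxtimes H)=2\operatorname{gp}(H)\qquad\text{and}\qquad \operatorname{gp}(C_5\boxtimes H)=\operatorname{gp}(C_6\boxtimes H)=3\operatorname{gp}(H).$$
   Context: All graphs are finite, simple and connected. $d_G(u,v)$ is the usual shortest-path distance in $G$. A set $S\subseteq V(G)$ is a general position set of $G$ if no vertex of $S$ lies on a shortest path between two other vertices of $S$; equivalently, $d_G(u,v)\ne d_G(u,w)+d_G(w,v)$ for all pairwise distinct $u,v,w\in S$. The general position number $\operatorname{gp}(G)$ is the maximum cardinality of a general position set of $G$. The strong product $G\boxtimes H$ has vertex set $V(G)\times V(H)$; distinct vertices $(u_x,u_y)$ and $(v_x,v_y)$ are adjacent if and only if ($u_x=v_x$ and $u_yv_y\in E(H)$), or ($u_y=v_y$ and $u_xv_x\in E(G)$), or ($u_xv_x\in E(G)$ and $u_yv_y\in E(H)$). $C_n$ is the cycle on $n$ vertices. *)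

theory Defs
  imports "Graph_Theory.Graph_Theory"
begin

text \<open>
  A finite simple graph is a \<^term>\<open>pair_graph\<close>: a finite, loop-free, symmetric relation
  \<^const>\<open>parcs\<close> on the vertex set \<^const>\<open>pverts\<close>, so an undirected edge \<open>uv\<close> is present as both
  arcs \<open>(u, v)\<close> and \<open>(v, u)\<close>.
\<close>

definition gdist :: "'a pair_pre_digraph \<Rightarrow> 'a \<Rightarrow> 'a \<Rightarrow> ereal" where
  "gdist G u v = wf_digraph.\<mu> (with_proj G) (\<lambda>_. 1) u v"

definition general_position :: "'a pair_pre_digraph \<Rightarrow> 'a set \<Rightarrow> bool" where
  "general_position G S \<longleftrightarrow> S \<subseteq> pverts G \<and>
     (\<forall>u\<in>S. \<forall>v\<in>S. \<forall>w\<in>S. u \<noteq> v \<and> u \<noteq> w \<and> v \<noteq> w \<longrightarrow>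
        gdist G u v \<noteq> gdist G u w + gdist G w v)"

definition gp :: "'a pair_pre_digraph \<Rightarrow> nat" where
  "gp G = Max (card ` {S. general_position G S})"

definition strong_product ::
    "'a pair_pre_digraph \<Rightarrow> 'b pair_pre_digraph \<Rightarrow> ('a \<times> 'b) pair_pre_digraph"
    (infixr \<open>\<boxtimes>\<close> 75) where
  "G \<boxtimes> H = \<lparr> pverts = pverts G \<times> pverts H,
     parcs = {((ux, uy), (vx, vy)).
       ux \<in> pverts G \<and> uy \<in> pverts H \<and> vx \<in> pverts G \<and> vy \<in> pverts H \<and>
       (ux = vx \<and> (uy, vy) \<in> parcs H \<or>
        uy = vy \<and> (ux, vx) \<in> parcs G \<or>
        (ux, vx) \<in> parcs G \<and> (uy, vy) \<in> parcs H)} \<rparr>"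

text \<open>The cycle on the vertices \<open>0, \<dots>, n - 1\<close>; meaningful for \<open>n \<ge> 3\<close> only.\<close>

definition cycle_graph :: "nat \<Rightarrow> nat pair_pre_digraph" where
  "cycle_graph n = \<lparr> pverts = {..<n},
     parcs = {(i, j). i < n \<and> j < n \<and> (j = Suc i mod n \<or> i = Suc j mod n)} \<rparr>"

lemma pair_graph_cycle_graph:
  assumes "n \<ge> 3"
  shows "pair_graph (cycle_graph n)"
proof -
  have "finite (parcs (cycle_graph n))"
    by (rule finite_subset[of _ "{..<n} \<times> {..<n}"]) (auto simp: cycle_graph_def)
  moreover have "Suc i mod n \<noteq> i" if "i < n" for i
    using assms that by (cases "Suc i = n") auto
  ultimately show ?thesis
    by unfold_locales (auto simp: cycle_graph_def symmetric_def dest: sym intro!: symI)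
qed

lemma pair_graph_strong_product:
  assumes "pair_graph G" "pair_graph H"
  shows "pair_graph (G \<boxtimes> H)"
proof -
  interpret G: pair_graph G by fact
  interpret H: pair_graph H by fact
  have fin: "finite (pverts G \<times> pverts H)"
    using G.pair_finite_verts H.pair_finite_verts by blast
  moreover have "finite (parcs (G \<boxtimes> H))"
    by (rule finite_subset[OF _ finite_cartesian_product[OF fin fin]])
      (auto simp: strong_product_def)
  moreover have "sym (parcs G)" "sym (parcs H)"
    using G.pair_sym_arcs H.pair_sym_arcs by (simp_all add: symmetric_def)
  ultimately show ?thesis
    by unfold_locales
      (auto simp: strong_product_def symmetric_def
        dest: symD G.pair_no_loops H.pair_no_loops intro!: symI)
qed

end

theory Submission
  imports Defs
begin

text \<open>
  The distance in a strong product is the maximum of the distances of the coordinates. From this,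
  the product of two general position sets is again in general position (\<open>gp_mult_le\<close>), and the
  lower bounds follow from \<open>gp C\<^sub>4 \<ge> 2\<close>, \<open>gp C\<^sub>5 \<ge> 3\<close> and \<open>gp C\<^sub>6 \<ge> 3\<close>.

  For the upper bounds, let \<open>S\<close> be a general position set of \<open>C \<boxtimes> H\<close>. Call a set of points
  nonexpansive if any two of its points are at most as far apart in \<open>C\<close> as they are in \<open>H\<close>. The
  projection to \<open>H\<close> maps such a subset of \<open>S\<close> isometrically, hence injectively, onto a general
  position set of \<open>H\<close>, so it has at most \<open>gp H\<close> points (\<open>card_nonexpansive_le\<close>). It therefore
  suffices to split \<open>S\<close> into two nonexpansive sets for \<open>C\<^sub>4\<close> and into three for \<open>C\<^sub>5\<close> and \<open>C\<^sub>6\<close>.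

  Cut the cycle into blocks, each of them an edge or a single vertex, and classify the points of
  \<open>S\<close> by the block of their first coordinate. A class can only fail to be nonexpansive if it
  contains both \<open>(a, h)\<close> and \<open>(b, h)\<close> for a block \<open>{a, b}\<close>; one of these two points is then moved
  to another class. This does no harm because of \<open>edge_in_fibre\<close>: if another point \<open>(g, k)\<close> of \<open>S\<close>
  had \<open>d(a, g) > d(h, k)\<close>, then whichever of \<open>(a, h)\<close> and \<open>(b, h)\<close> is farther from \<open>(g, k)\<close> would
  reach it by a shortest path through the other one, unless \<open>a\<close> and \<open>b\<close> are equally far from \<open>g\<close>.
  In an even cycle parity excludes equal distances, so a point can be moved to the next block. In
  \<open>C\<^sub>5\<close> only the vertex opposite to the edge is equally far from both ends; with blocks \<open>{0, 1}\<close>,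
  \<open>{2, 3}\<close>, \<open>{4}\<close> the points over \<open>1\<close> and \<open>2\<close> can be moved to the class of \<open>4\<close>, which avoids the
  opposite vertices \<open>3\<close> and \<open>0\<close>.
\<close>

section \<open>Distance as the length of a shortest walk\<close>

text \<open>
  The least walk length, used for connected graphs only: there it is a natural number, and induction
  over powers of the arc relation replaces reasoning about infima of walk costs.
\<close>

definition hop_dist :: "'a pair_pre_digraph \<Rightarrow> 'a \<Rightarrow> 'a \<Rightarrow> nat" where
  "hop_dist G u v = (LEAST m. (u, v) \<in> parcs G ^^ m)"

lemma hop_dist_le: "(u, v) \<in> parcs G ^^ m \<Longrightarrow> hop_dist G u v \<le> m"
  unfolding hop_dist_def by (rule Least_le)

lemma hop_dist_self [simp]: "hop_dist G u u = 0"
  using hop_dist_le[where G = G and m = 0] by simp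

lemma sym_relpow: "sym R \<Longrightarrow> (u, v) \<in> R ^^ m \<Longrightarrow> (v, u) \<in> R ^^ m"
proof (induction m arbitrary: v)
  case (Suc m)
  then show ?case by (meson relpow_Suc_E relpow_Suc_I2 symD)
qed simp

text \<open>
  Together with the next lemma this certifies a proposed formula \<open>f\<close> for the distance from \<open>u\<close>. A
  function that grows by at most one along each arc is a lower bound for the length of walks, and a
  function that can always be decreased to zero by stepping backwards along arcs yields a walk of
  that length.
\<close>

lemma relpow_le_slope:
  fixes f :: "'a \<Rightarrow> nat"
  assumes "(u, v) \<in> R ^^ m" and "\<And>x y. (x, y) \<in> R \<Longrightarrow> f y \<le> Suc (f x)"
  shows "f v \<le> f u + m"
  using assms(1)
proof (induction m arbitrary: v)
  case (Suc m)
  then obtain x where "(u, x) \<in> R ^^ m" "(x, v) \<in> R" by (auto elim: relpow_Suc_E)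
  then show ?case using Suc.IH assms(2)[of x v] by fastforce
qed simp

lemma relpow_descent:
  fixes f :: "'a \<Rightarrow> nat"
  assumes "v \<in> V"
    and "\<And>x. x \<in> V \<Longrightarrow> f x = 0 \<Longrightarrow> x = u"
    and "\<And>x m. x \<in> V \<Longrightarrow> f x = Suc m \<Longrightarrow> \<exists>y\<in>V. (y, x) \<in> R \<and> f y = m"
  shows "(u, v) \<in> R ^^ f v"
  using assms(1)
proof (induction "f v" arbitrary: v)
  case 0
  then have "v = u" using assms(2) by simp
  then show ?case using 0(1) by (metis relpow_0_I)
next
  case (Suc m)
  then obtain y where "y \<in> V" "(y, v) \<in> R" "f y = m" using assms(3) by metis
  then show ?case using Suc by (metis relpow_Suc_I)
qed

locale walk_connected = pair_graph G for G :: "'a pair_pre_digraph" +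
  assumes walk_exists: "u \<in> pverts G \<Longrightarrow> v \<in> pverts G \<Longrightarrow> (u, v) \<in> (parcs G)\<^sup>*"
begin

lemma sym_parcs: "sym (parcs G)"
  using pair_sym_arcs by (simp add: symmetric_def)

lemma shortest_walk:
  assumes "u \<in> pverts G" "v \<in> pverts G"
  shows "(u, v) \<in> parcs G ^^ hop_dist G u v"
proof -
  obtain m where "(u, v) \<in> parcs G ^^ m"
    using walk_exists[OF assms] by (auto simp: rtrancl_power)
  then show ?thesis unfolding hop_dist_def by (rule LeastI)
qed

lemma hop_dist_sym:
  assumes "u \<in> pverts G" "v \<in> pverts G"
  shows "hop_dist G u v = hop_dist G v u"
  by (meson antisym assms hop_dist_le shortest_walk sym_parcs sym_relpow)

lemma hop_dist_triangle:
  assumes "u \<in> pverts G" "v \<in> pverts G" "w \<in> pverts G"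
  shows "hop_dist G u v \<le> hop_dist G u w + hop_dist G w v"
  using assms by (intro hop_dist_le) (auto simp: relpow_add intro: relcompI shortest_walk)

lemma hop_dist_eq_0_iff:
  assumes "u \<in> pverts G" "v \<in> pverts G"
  shows "hop_dist G u v = 0 \<longleftrightarrow> u = v"
  using shortest_walk[OF assms] by (cases "hop_dist G u v = 0") auto

lemma hop_dist_arc:
  assumes "(u, v) \<in> parcs G"
  shows "hop_dist G u v = 1"
proof -
  have "u \<in> pverts G" "v \<in> pverts G" "u \<noteq> v"
    using assms in_arcsD1 in_arcsD2 no_loops' by auto
  moreover have "hop_dist G u v \<le> 1" using assms by (intro hop_dist_le) simp
  ultimately show ?thesis using hop_dist_eq_0_iff by force
qed

lemma hop_dist_eq_1_iff:
  assumes "u \<in> pverts G" "v \<in> pverts G"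
  shows "hop_dist G u v = 1 \<longleftrightarrow> (u, v) \<in> parcs G"
  using shortest_walk[OF assms] hop_dist_arc by (metis relpow_1)

lemma hop_dist_step:
  assumes "u \<in> pverts G" "(v, w) \<in> parcs G"
  shows "hop_dist G u w \<le> Suc (hop_dist G u v)"
  using hop_dist_triangle[of u w v] hop_dist_arc[OF assms(2)] assms in_arcsD1 in_arcsD2 by auto

lemma hop_dist_eq_2I:
  assumes "(u, w) \<in> parcs G" "(w, v) \<in> parcs G" "u \<noteq> v" "(u, v) \<notin> parcs G"
  shows "hop_dist G u v = 2"
proof -
  have V: "u \<in> pverts G" "v \<in> pverts G" using assms in_arcsD1 in_arcsD2 by auto
  have "hop_dist G u v \<le> Suc (hop_dist G u w)" using assms V by (intro hop_dist_step)
  then show ?thesis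
    using hop_dist_arc[OF assms(1)] hop_dist_eq_0_iff[OF V] hop_dist_eq_1_iff[OF V] assms by auto
qed

lemma hop_dist_Suc:
  assumes "u \<in> pverts G" "v \<in> pverts G" "hop_dist G u v = Suc m"
  obtains w where "w \<in> pverts G" "(w, v) \<in> parcs G" "hop_dist G u w = m"
proof -
  from shortest_walk[OF assms(1,2)] assms(3) obtain w
    where w: "(u, w) \<in> parcs G ^^ m" "(w, v) \<in> parcs G"
    by (auto elim: relpow_Suc_E)
  have "hop_dist G u w \<le> m" using w by (intro hop_dist_le)
  moreover have "Suc m \<le> Suc (hop_dist G u w)" using hop_dist_step[OF assms(1) w(2)] assms(3) by simp
  ultimately show ?thesis using that w in_arcsD1 by auto
qed

text \<open>
  The bridge from the arc-list walks in the definition of \<^const>\<open>gdist\<close> to powers of the arc relation.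
\<close>

lemma awalk_length_iff_relpow:
  assumes "u \<in> pverts G"
  shows "(\<exists>p. awalk u p v \<and> length p = m) \<longleftrightarrow> (u, v) \<in> parcs G ^^ m"
  using assms
proof (induction m arbitrary: u)
  case 0
  then show ?case by (auto simp: awalk_Nil_iff)
next
  case (Suc m)
  show ?case
  proof
    assume "\<exists>p. awalk u p v \<and> length p = Suc m"
    then obtain e p where "awalk u (e # p) v" "length p = m" by (auto simp: length_Suc_conv)
    then have "e \<in> parcs G" "fst e = u" "awalk (snd e) p v" by (auto simp: awalk_Cons_iff)
    then show "(u, v) \<in> parcs G ^^ Suc m"
      using Suc.IH[of "snd e"] \<open>length p = m\<close> in_arcsD2
      by (metis prod.collapse relpow_Suc_I2)
  next
    assume "(u, v) \<in> parcs G ^^ Suc m"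
    then obtain w where w: "(u, w) \<in> parcs G" "(w, v) \<in> parcs G ^^ m"
      by (elim relpow_Suc_E2)
    then obtain p where "awalk w p v" "length p = m" using Suc.IH[of w] in_arcsD2 by blast
    then have "awalk u ((u, w) # p) v" using w by (simp add: awalk_Cons_iff)
    then show "\<exists>p. awalk u p v \<and> length p = Suc m" using \<open>length p = m\<close> by (metis length_Cons)
  qed
qed

lemma gdist_eq_hop_dist:
  assumes "u \<in> pverts G" "v \<in> pverts G"
  shows "gdist G u v = ereal (real (hop_dist G u v))"
proof -
  have cost: "awalk_cost (\<lambda>_. 1) p = real (length p)" for p
    by (induction p) auto
  obtain p where p: "awalk u p v" "length p = hop_dist G u v"
    using awalk_length_iff_relpow shortest_walk assms by blast
  have "hop_dist G u v \<le> length q" if "awalk u q v" for q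
    using awalk_length_iff_relpow assms that by (blast intro: hop_dist_le)
  then have "(INF p\<in>{p. awalk u p v}. ereal (real (length p))) = ereal (real (hop_dist G u v))"
    using p by (intro antisym INF_greatest INF_lower2[of p]) auto
  then show ?thesis unfolding gdist_def \<mu>_def cost .
qed

lemma general_position_iff:
  "general_position G S \<longleftrightarrow> S \<subseteq> pverts G \<and>
     (\<forall>u\<in>S. \<forall>v\<in>S. \<forall>w\<in>S. u \<noteq> v \<and> u \<noteq> w \<and> v \<noteq> w \<longrightarrow>
        hop_dist G u v \<noteq> hop_dist G u w + hop_dist G w v)"
proof (cases "S \<subseteq> pverts G")
  case True
  have "gdist G u v = gdist G u w + gdist G w v \<longleftrightarrow>
      hop_dist G u v = hop_dist G u w + hop_dist G w v"
    if "u \<in> S" "v \<in> S" "w \<in> S" for u v w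
    using True that by (auto simp: gdist_eq_hop_dist subset_iff simp flip: of_nat_add)
  then show ?thesis unfolding general_position_def by (auto simp: True)
qed (simp add: general_position_def)

lemma general_positionD:
  assumes "general_position G S" "u \<in> S" "v \<in> S" "w \<in> S" "u \<noteq> v" "u \<noteq> w" "v \<noteq> w"
  shows "hop_dist G u v \<noteq> hop_dist G u w + hop_dist G w v"
  using assms unfolding general_position_iff by blast

lemma finite_general_positions: "finite {S. general_position G S}"
  by (rule finite_subset[of _ "Pow (pverts G)"]) (auto simp: general_position_def pair_finite_verts)

lemma finite_general_position: "general_position G S \<Longrightarrow> finite S"
  using finite_subset[OF _ pair_finite_verts] by (simp add: general_position_def)

lemma card_le_gp: "general_position G S \<Longrightarrow> card S \<le> gp G"
  unfolding gp_def using finite_general_positions by (intro Max_ge) auto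

lemma gp_attained: obtains S where "general_position G S" "card S = gp G"
proof -
  have "general_position G {}" by (simp add: general_position_def)
  then have "gp G \<in> card ` {S. general_position G S}"
    unfolding gp_def using finite_general_positions by (intro Max_in) auto
  then show ?thesis using that by auto
qed

end

section \<open>The strong product\<close>

locale strong_product_factors = G: walk_connected G + H: walk_connected H
  for G :: "'a pair_pre_digraph" and H :: "'b pair_pre_digraph"
begin

abbreviation prod_dist :: "'a \<times> 'b \<Rightarrow> 'a \<times> 'b \<Rightarrow> nat" where
  "prod_dist p q \<equiv> max (hop_dist G (fst p) (fst q)) (hop_dist H (snd p) (snd q))"

text \<open>
  A walk in the product may advance in both coordinates at once, so only the coordinates that attain
  the maximum need to step back, and both can do so with a single arc.
\<close>

lemma prod_dist_descent:
  assumes "p \<in> pverts (G \<boxtimes> H)" "q \<in> pverts (G \<boxtimes> H)" "prod_dist p q = Suc m"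
  shows "\<exists>r\<in>pverts (G \<boxtimes> H). (r, q) \<in> parcs (G \<boxtimes> H) \<and> prod_dist p r = m"
proof -
  obtain a b c d where [simp]: "p = (a, b)" "q = (c, d)" by (metis surj_pair)
  have V: "a \<in> pverts G" "b \<in> pverts H" "c \<in> pverts G" "d \<in> pverts H"
    using assms by (auto simp: strong_product_def)
  have max: "max (hop_dist G a c) (hop_dist H b d) = Suc m" using assms by simp
  show ?thesis
  proof (cases "hop_dist G a c = Suc m")
    case True
    with V obtain c' where c': "c' \<in> pverts G" "(c', c) \<in> parcs G" "hop_dist G a c' = m"
      by (metis G.hop_dist_Suc)
    show ?thesis
    proof (cases "hop_dist H b d = Suc m")
      case True
      with V obtain d' where "d' \<in> pverts H" "(d', d) \<in> parcs H" "hop_dist H b d' = m"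
        by (metis H.hop_dist_Suc)
      then show ?thesis
        using c' V by (intro bexI[of _ "(c', d')"]) (auto simp: strong_product_def)
    next
      case False
      then show ?thesis
        using c' V max by (intro bexI[of _ "(c', d)"]) (auto simp: strong_product_def max_def split: if_splits)
    qed
  next
    case False
    then have "hop_dist H b d = Suc m" using max by (auto simp: max_def split: if_splits)
    with V obtain d' where "d' \<in> pverts H" "(d', d) \<in> parcs H" "hop_dist H b d' = m"
      by (metis H.hop_dist_Suc)
    then show ?thesis
      using False V max by (intro bexI[of _ "(c, d')"]) (auto simp: strong_product_def max_def split: if_splits)
  qed
qed

lemma relpow_prod_dist:
  assumes "p \<in> pverts (G \<boxtimes> H)" "q \<in> pverts (G \<boxtimes> H)"
  shows "(p, q) \<in> parcs (G \<boxtimes> H) ^^ prod_dist p q"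
proof (rule relpow_descent[where V = "pverts (G \<boxtimes> H)" and f = "prod_dist p"])
  fix x assume "x \<in> pverts (G \<boxtimes> H)" "prod_dist p x = 0"
  then show "x = p"
    using assms G.hop_dist_eq_0_iff H.hop_dist_eq_0_iff by (force simp: strong_product_def)
qed (use assms prod_dist_descent in auto)

lemma hop_dist_strong_product:
  assumes "p \<in> pverts (G \<boxtimes> H)" "q \<in> pverts (G \<boxtimes> H)"
  shows "hop_dist (G \<boxtimes> H) p q = prod_dist p q"
proof (rule antisym)
  show "hop_dist (G \<boxtimes> H) p q \<le> prod_dist p q"
    using assms by (intro hop_dist_le relpow_prod_dist)
  have "(p, q) \<in> parcs (G \<boxtimes> H) ^^ hop_dist (G \<boxtimes> H) p q"
    unfolding hop_dist_def by (rule LeastI, rule relpow_prod_dist[OF assms])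
  then have "prod_dist p q \<le> prod_dist p p + hop_dist (G \<boxtimes> H) p q"
  proof (rule relpow_le_slope)
    fix x y assume "(x, y) \<in> parcs (G \<boxtimes> H)"
    then show "prod_dist p y \<le> Suc (prod_dist p x)"
      using assms G.hop_dist_step[of "fst p" "fst x" "fst y"] H.hop_dist_step[of "snd p" "snd x" "snd y"]
      by (auto simp: strong_product_def max_def)
  qed
  then show "prod_dist p q \<le> hop_dist (G \<boxtimes> H) p q" by simp
qed

sublocale P: walk_connected "G \<boxtimes> H"
proof (intro walk_connected.intro walk_connected_axioms.intro)
  show "pair_graph (G \<boxtimes> H)"
    by (intro pair_graph_strong_product G.pair_graph H.pair_graph)
  show "(p, q) \<in> (parcs (G \<boxtimes> H))\<^sup>*" if "p \<in> pverts (G \<boxtimes> H)" "q \<in> pverts (G \<boxtimes> H)" for p q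
    using relpow_prod_dist[OF that] by (auto simp: rtrancl_power)
qed

text \<open>
  If the maximum for the outer pair \<open>p\<close>, \<open>q\<close> is attained in one coordinate, then equality of the
  distances forces equality in that coordinate, whose entries hence cannot be distinct. Two
  coinciding entries make one of the two summands vanish, so \<open>r\<close> is \<open>p\<close> or \<open>q\<close>.
\<close>

lemma general_position_Times:
  assumes S: "general_position G S" and T: "general_position H T"
  shows "general_position (G \<boxtimes> H) (S \<times> T)"
  unfolding P.general_position_iff
proof (intro conjI ballI impI notI)
  have ST: "S \<subseteq> pverts G" "T \<subseteq> pverts H" using S T by (simp_all add: general_position_def)
  then show V: "S \<times> T \<subseteq> pverts (G \<boxtimes> H)" by (auto simp: strong_product_def)
  fix p q r assume mem: "p \<in> S \<times> T" "q \<in> S \<times> T" "r \<in> S \<times> T"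
    and neq: "p \<noteq> q \<and> p \<noteq> r \<and> q \<noteq> r"
    and eq: "hop_dist (G \<boxtimes> H) p q = hop_dist (G \<boxtimes> H) p r + hop_dist (G \<boxtimes> H) r q"
  obtain a b c d e f where [simp]: "p = (a, b)" "q = (c, d)" "r = (e, f)" by (metis surj_pair)
  have V': "a \<in> pverts G" "c \<in> pverts G" "e \<in> pverts G" "b \<in> pverts H" "d \<in> pverts H" "f \<in> pverts H"
    using mem ST by auto
  have "prod_dist p q = prod_dist p r + prod_dist r q"
    using eq mem V by (simp add: hop_dist_strong_product subset_iff)
  then consider "hop_dist G a c = prod_dist p r + prod_dist r q"
    | "hop_dist H b d = prod_dist p r + prod_dist r q" by (auto simp: max_def split: if_splits)
  then show False
  proof cases
    case 1
    then have G: "hop_dist G a c = hop_dist G a e + hop_dist G e c"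
      and H: "hop_dist H b f \<le> hop_dist G a e" "hop_dist H f d \<le> hop_dist G e c"
      using G.hop_dist_triangle[of a c e] V' by auto
    have "a = c \<or> a = e \<or> c = e" using G.general_positionD[OF S, of a c e] G mem by auto
    then have "hop_dist G a e = 0 \<or> hop_dist G e c = 0" using G by auto
    then have "hop_dist G a e = 0 \<and> hop_dist H b f = 0 \<or> hop_dist G e c = 0 \<and> hop_dist H f d = 0"
      using H by linarith
    then show False
      using neq V' G.hop_dist_eq_0_iff H.hop_dist_eq_0_iff by auto
  next
    case 2
    then have H: "hop_dist H b d = hop_dist H b f + hop_dist H f d"
      and G: "hop_dist G a e \<le> hop_dist H b f" "hop_dist G e c \<le> hop_dist H f d"
      using H.hop_dist_triangle[of b d f] V' by auto
    have "b = d \<or> b = f \<or> d = f" using H.general_positionD[OF T, of b d f] H mem by auto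
    then have "hop_dist H b f = 0 \<or> hop_dist H f d = 0" using H by auto
    then have "hop_dist H b f = 0 \<and> hop_dist G a e = 0 \<or> hop_dist H f d = 0 \<and> hop_dist G e c = 0"
      using G by linarith
    then show False
      using neq V' G.hop_dist_eq_0_iff H.hop_dist_eq_0_iff by auto
  qed
qed

lemma gp_mult_le: "gp G * gp H \<le> gp (G \<boxtimes> H)"
proof -
  obtain S T where "general_position G S" "card S = gp G" "general_position H T" "card T = gp H"
    by (metis G.gp_attained H.gp_attained)
  then show ?thesis
    using P.card_le_gp[OF general_position_Times] by (metis card_cartesian_product)
qed

section \<open>Upper bounds from colourings with nonexpansive classes\<close>

text \<open>
  The second coordinate determines the first on such a set, which is thus the graph of a map from a
  subset of \<open>H\<close> to \<open>G\<close> that does not increase distances.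
\<close>

definition nonexpansive :: "('a \<times> 'b) set \<Rightarrow> bool" where
  "nonexpansive U \<longleftrightarrow>
    (\<forall>p\<in>U. \<forall>q\<in>U. hop_dist G (fst p) (fst q) \<le> hop_dist H (snd p) (snd q))"

text \<open>
  On \<open>U\<close> the distance of the product is the distance of the second coordinates, so the projection
  to \<open>H\<close> preserves general position and loses no points.
\<close>

lemma card_nonexpansive_le:
  assumes S: "general_position (G \<boxtimes> H) S" and "U \<subseteq> S" and U: "nonexpansive U"
  shows "card U \<le> gp H"
proof -
  have V: "U \<subseteq> pverts (G \<boxtimes> H)" using assms by (auto simp: general_position_def)
  have V': "fst p \<in> pverts G" "snd p \<in> pverts H" if "p \<in> U" for p
    using V that by (auto simp: strong_product_def)
  have d: "hop_dist (G \<boxtimes> H) p q = hop_dist H (snd p) (snd q)" if "p \<in> U" "q \<in> U" for p q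
    using that U V by (subst hop_dist_strong_product) (auto simp: nonexpansive_def max_def)
  have inj: "inj_on snd U"
    using V d P.hop_dist_eq_0_iff by (intro inj_onI) (metis H.hop_dist_eq_0_iff V' subsetD)
  have "general_position H (snd ` U)"
    unfolding H.general_position_iff
  proof (intro conjI ballI impI)
    show "snd ` U \<subseteq> pverts H" using V' by auto
    fix u v w assume "u \<in> snd ` U" "v \<in> snd ` U" "w \<in> snd ` U" and neq: "u \<noteq> v \<and> u \<noteq> w \<and> v \<noteq> w"
    then obtain p q r where "p \<in> U" "q \<in> U" "r \<in> U" "u = snd p" "v = snd q" "w = snd r" by auto
    moreover from this have "hop_dist (G \<boxtimes> H) p q \<noteq> hop_dist (G \<boxtimes> H) p r + hop_dist (G \<boxtimes> H) r q"
      using P.general_positionD[OF S] \<open>U \<subseteq> S\<close> neq by blast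
    ultimately show "hop_dist H u v \<noteq> hop_dist H u w + hop_dist H w v"
      using d by simp
  qed
  from H.card_le_gp[OF this] show ?thesis by (simp add: card_image inj)
qed

lemma gp_le_colours:
  assumes "\<And>S. general_position (G \<boxtimes> H) S \<Longrightarrow>
      \<exists>colour. colour ` S \<subseteq> {..<k} \<and> (\<forall>c. nonexpansive {p \<in> S. colour p = c})"
  shows "gp (G \<boxtimes> H) \<le> k * gp H"
proof -
  obtain S where S: "general_position (G \<boxtimes> H) S" "card S = gp (G \<boxtimes> H)"
    by (rule P.gp_attained)
  obtain colour :: "'a \<times> 'b \<Rightarrow> nat" where c: "colour ` S \<subseteq> {..<k}"
      "\<And>c. nonexpansive {p \<in> S. colour p = c}"
    using assms S by metis
  have "S = (\<Union>c<k. {p \<in> S. colour p = c})" using c by auto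
  then have "card S \<le> (\<Sum>c<k. card {p \<in> S. colour p = c})"
    by (metis card_UN_le finite_lessThan)
  also have "\<dots> \<le> (\<Sum>c<k. gp H)"
    using S c by (intro sum_mono card_nonexpansive_le) auto
  finally show ?thesis using S by simp
qed

text \<open>
  The distances from \<open>a\<close> and \<open>b\<close> to \<open>g\<close> differ by exactly one. If the conclusion failed, these
  distances would decide the distances in the product, and the nearer of \<open>(a, h)\<close> and \<open>(b, h)\<close>
  would lie on a shortest path from the other one to \<open>(g, k)\<close>. The case \<open>h = k\<close> is included on
  purpose: it shows that two points over the same vertex of \<open>H\<close> cannot meet in one class.
\<close>

lemma edge_in_fibre:
  assumes S: "general_position (G \<boxtimes> H) S"
    and mem: "(a, h) \<in> S" "(b, h) \<in> S" "(g, k) \<in> S"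
    and arc: "(a, b) \<in> parcs G"
    and neq: "(g, k) \<noteq> (a, h)" "(g, k) \<noteq> (b, h)"
    and uneven: "hop_dist G a g \<noteq> hop_dist G b g"
  shows "hop_dist G a g \<le> hop_dist H h k"
proof (rule ccontr)
  assume far: "\<not> hop_dist G a g \<le> hop_dist H h k"
  have V: "a \<in> pverts G" "b \<in> pverts G" "g \<in> pverts G" and P: "S \<subseteq> pverts (G \<boxtimes> H)"
    using S mem by (auto simp: general_position_def strong_product_def)
  have ab: "a \<noteq> b" "hop_dist G a b = 1" "hop_dist G b a = 1"
    using arc G.no_loops' G.hop_dist_arc G.hop_dist_sym V by auto
  have d: "hop_dist (G \<boxtimes> H) p q = prod_dist p q" if "p \<in> S" "q \<in> S" for p q
    using that P by (intro hop_dist_strong_product) auto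
  have gp: "prod_dist p q \<noteq> prod_dist p r + prod_dist r q"
    if "p \<in> S" "q \<in> S" "r \<in> S" "p \<noteq> q" "p \<noteq> r" "q \<noteq> r" for p q r
    using P.general_positionD[OF S, of p q r] that d by simp
  have "hop_dist G a g = Suc (hop_dist G b g) \<or> hop_dist G b g = Suc (hop_dist G a g)"
    using G.hop_dist_triangle[of a g b] G.hop_dist_triangle[of b g a] V ab uneven by auto
  then show False
  proof
    assume "hop_dist G a g = Suc (hop_dist G b g)"
    then show False
      using gp[of "(a, h)" "(g, k)" "(b, h)"] mem neq ab far by auto
  next
    assume "hop_dist G b g = Suc (hop_dist G a g)"
    then show False
      using gp[of "(b, h)" "(g, k)" "(a, h)"] mem neq ab far by auto
  qed
qed

text \<open>
  The vertices in \<open>M\<close> are those whose points may be moved: if \<open>S\<close> contains a point over \<open>v \<in> M\<close> and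
  the point over \<open>partner v\<close> with the same second coordinate, then the former leaves the class of
  its block for the class \<open>target v\<close>. The assumption \<open>apart\<close> keeps the partner out of that class, and
  \<open>uneven\<close> makes \<open>edge_in_fibre\<close> applicable to all first coordinates that can occur in it.
\<close>

lemma gp_le_blocks:
  fixes block target :: "'a \<Rightarrow> nat"
  assumes range: "\<And>v. v \<in> pverts G \<Longrightarrow> block v < k" "\<And>v. v \<in> M \<Longrightarrow> target v < k"
    and edge: "\<And>v. v \<in> M \<Longrightarrow> (v, partner v) \<in> parcs G"
    and block: "\<And>u v. u \<in> pverts G \<Longrightarrow> v \<in> pverts G \<Longrightarrow> u \<noteq> v \<Longrightarrow> block u = block v \<Longrightarrow>
      u \<in> M \<and> v = partner u \<or> v \<in> M \<and> u = partner v"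
    and apart: "\<And>v. v \<in> M \<Longrightarrow> partner v \<notin> M \<and> block (partner v) \<noteq> target v"
    and uneven: "\<And>v w. v \<in> M \<Longrightarrow> w \<in> pverts G \<Longrightarrow>
      block w = target v \<or> w \<in> M \<and> target w = target v \<Longrightarrow>
      hop_dist G v w \<noteq> hop_dist G (partner v) w"
  shows "gp (G \<boxtimes> H) \<le> k * gp H"
proof (rule gp_le_colours)
  fix S assume S: "general_position (G \<boxtimes> H) S"
  have V: "fst p \<in> pverts G" "snd p \<in> pverts H" if "p \<in> S" for p
    using S that by (auto simp: general_position_def strong_product_def)
  define moved where "moved p \<longleftrightarrow> fst p \<in> M \<and> (partner (fst p), snd p) \<in> S" for p
  define colour where "colour p = (if moved p then target (fst p) else block (fst p))" for p
  \<comment> \<open>A moved point is not too far from any other point of its new class: the partner stays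
    outside that class, so the other point is a legitimate third point beside the edge in the fibre.\<close>
  have close: "hop_dist G (fst p) (fst q) \<le> hop_dist H (snd p) (snd q)"
    if p: "p \<in> S" "moved p" and q: "q \<in> S" "colour q = colour p" for p q
  proof (cases "p = q")
    case False
    obtain v h where [simp]: "p = (v, h)" by (metis surj_pair)
    have v: "v \<in> M" "(partner v, h) \<in> S" using p by (auto simp: moved_def)
    have target: "block (fst q) = target v \<or> fst q \<in> M \<and> target (fst q) = target v"
      using p q by (auto simp: colour_def moved_def split: if_splits)
    then have "q \<noteq> (partner v, h)" using apart[OF v(1)] by auto
    then show ?thesis
      using edge_in_fibre[OF S, of v h "partner v" "fst q" "snd q"] uneven[OF v(1) V(1) target]
        p q v edge False by auto
  qed simp
  have "nonexpansive {p \<in> S. colour p = c}" for c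
    unfolding nonexpansive_def
  proof (intro ballI)
    fix p q assume pq: "p \<in> {p \<in> S. colour p = c}" "q \<in> {p \<in> S. colour p = c}"
    then have Vp: "fst p \<in> pverts G" "snd p \<in> pverts H" and Vq: "fst q \<in> pverts G" "snd q \<in> pverts H"
      using V by auto
    consider "moved p" | "moved q" | "\<not> moved p" "\<not> moved q" by blast
    then show "hop_dist G (fst p) (fst q) \<le> hop_dist H (snd p) (snd q)"
    proof cases
      case 1
      then show ?thesis using close[of p q] pq by auto
    next
      case 2
      then have "hop_dist G (fst q) (fst p) \<le> hop_dist H (snd q) (snd p)"
        using close[of q p] pq by auto
      then show ?thesis
        using G.hop_dist_sym[OF Vp(1) Vq(1)] H.hop_dist_sym[OF Vp(2) Vq(2)] by simp
    next
      case 3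
      then have eq: "block (fst p) = block (fst q)" using pq by (simp add: colour_def)
      show ?thesis
      proof (cases "fst p = fst q")
        case False
        \<comment> \<open>Over the same vertex of \<open>H\<close> one of the two points would have been moved.\<close>
        note partners = block[OF Vp(1) Vq(1) False eq]
        then have "snd p \<noteq> snd q" using 3 pq by (cases p; cases q) (auto simp: moved_def)
        then have "hop_dist H (snd p) (snd q) \<noteq> 0" using Vp Vq H.hop_dist_eq_0_iff by simp
        moreover have "hop_dist G (fst p) (fst q) = 1"
          using partners edge G.hop_dist_arc G.hop_dist_sym[OF Vp(1) Vq(1)] by metis
        ultimately show ?thesis by simp
      qed simp
    qed
  qed
  moreover have "colour ` S \<subseteq> {..<k}"
    using V range by (auto simp: colour_def moved_def)
  ultimately show "\<exists>colour. colour ` S \<subseteq> {..<k} \<and> (\<forall>c. nonexpansive {p \<in> S. colour p = c})"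
    by blast
qed

end

section \<open>Cycles\<close>

lemma pverts_cycle_graph: "pverts (cycle_graph n) = {..<n}"
  by (simp add: cycle_graph_def)

lemma arc_cycle_graph:
  "(i, j) \<in> parcs (cycle_graph n) \<longleftrightarrow> i < n \<and> j < n \<and> (j = Suc i mod n \<or> i = Suc j mod n)"
  by (simp add: cycle_graph_def)

lemma walk_connected_cycle_graph:
  assumes "n \<ge> 3"
  shows "walk_connected (cycle_graph n)"
proof (intro walk_connected.intro walk_connected_axioms.intro pair_graph_cycle_graph assms)
  let ?R = "parcs (cycle_graph n)"
  have sym: "sym ?R" by (auto simp: pverts_cycle_graph arc_cycle_graph intro!: symI)
  have from0: "(0, i) \<in> ?R\<^sup>*" if "i < n" for i
    using that
  proof (induction i)
    case (Suc i)
    then have "(i, Suc i) \<in> ?R" by (simp add: pverts_cycle_graph arc_cycle_graph)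
    then show ?case using Suc by (meson Suc_lessD rtrancl.rtrancl_into_rtrancl)
  qed simp
  fix u v assume "u \<in> pverts (cycle_graph n)" "v \<in> pverts (cycle_graph n)"
  then have "(0, u) \<in> ?R\<^sup>*" "(0, v) \<in> ?R\<^sup>*" using from0 by (auto simp: pverts_cycle_graph arc_cycle_graph)
  then show "(u, v) \<in> ?R\<^sup>*" by (meson rtrancl_trans sym sym_rtrancl symD)
qed

text \<open>
  Every arc of an even cycle joins an even and an odd vertex. Consequently no vertex is equally far
  from both ends of an edge.
\<close>

lemma even_cycle_dist_parity:
  assumes "even n" "n \<ge> 3" "u < n" "v < n"
  shows "even (hop_dist (cycle_graph n) u v) \<longleftrightarrow> (even u \<longleftrightarrow> even v)"
proof -
  interpret walk_connected "cycle_graph n" by (rule walk_connected_cycle_graph) fact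
  have arc: "even x \<longleftrightarrow> odd y" if "(x, y) \<in> parcs (cycle_graph n)" for x y
    using that \<open>even n\<close> by (auto simp: pverts_cycle_graph arc_cycle_graph dvd_mod_iff)
  have "even m \<longleftrightarrow> (even u \<longleftrightarrow> even v)" if "(u, v) \<in> parcs (cycle_graph n) ^^ m" for m
    using that
  proof (induction m arbitrary: v)
    case (Suc m)
    then obtain x where "(u, x) \<in> parcs (cycle_graph n) ^^ m" "(x, v) \<in> parcs (cycle_graph n)"
      by (auto elim: relpow_Suc_E)
    then show ?case using Suc.IH arc by auto
  qed simp
  then show ?thesis using shortest_walk assms by (simp add: pverts_cycle_graph arc_cycle_graph)
qed

text \<open>
  The blocks are the edges \<open>{2 i, 2 i + 1}\<close>, and a point is moved from its block to the cyclically
  next one. For \<open>k \<ge> 2\<close> this is a different block.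
\<close>

lemma gp_even_cycle_strong_product_le:
  assumes k: "k \<ge> 2" and H: "walk_connected H"
  shows "gp (cycle_graph (2 * k) \<boxtimes> H) \<le> k * gp H"
proof -
  let ?C = "cycle_graph (2 * k)"
  interpret strong_product_factors ?C H
    using walk_connected_cycle_graph[of "2 * k"] k H by (auto simp: strong_product_factors_def)
  show ?thesis
  proof (rule gp_le_blocks[where block = "\<lambda>v. v div 2" and M = "{v. odd v \<and> v < 2 * k}"
        and partner = "\<lambda>v. v - 1" and target = "\<lambda>v. Suc (v div 2) mod k"])
    fix v assume v: "v \<in> {v. odd v \<and> v < 2 * k}"
    then obtain i where i: "v = Suc (2 * i)" "i < k" by (auto elim!: oddE)
    show "(v, v - 1) \<in> parcs ?C" using i by (simp add: pverts_cycle_graph arc_cycle_graph)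
    have "i \<noteq> Suc i mod k" using i k by (cases "Suc i = k") auto
    then show "v - 1 \<notin> {v. odd v \<and> v < 2 * k} \<and> (v - 1) div 2 \<noteq> Suc (v div 2) mod k"
      using i by simp
    fix w assume "w \<in> pverts ?C"
    then show "hop_dist ?C v w \<noteq> hop_dist ?C (v - 1) w"
      using even_cycle_dist_parity[of "2 * k" v w] even_cycle_dist_parity[of "2 * k" "v - 1" w] i k
      by (auto simp: pverts_cycle_graph arc_cycle_graph)
  next
    fix u v assume uv: "u \<in> pverts ?C" "v \<in> pverts ?C" "u \<noteq> v" "u div 2 = v div 2"
    from uv(3,4) have "odd u \<and> v = u - 1 \<or> odd v \<and> u = v - 1"
      by (cases "even u"; cases "even v") (auto elim!: evenE oddE)
    then show "u \<in> {v. odd v \<and> v < 2 * k} \<and> v = u - 1 \<or> v \<in> {v. odd v \<and> v < 2 * k} \<and> u = v - 1"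
      using uv by (auto simp: pverts_cycle_graph)
  qed (use k in \<open>auto simp: pverts_cycle_graph arc_cycle_graph\<close>)
qed

text \<open>
  The blocks are \<open>{0, 1}\<close>, \<open>{2, 3}\<close> and \<open>{4}\<close>. Points over \<open>1\<close> and \<open>2\<close> are moved to the class of \<open>4\<close>,
  where all first coordinates are \<open>1\<close>, \<open>2\<close> or \<open>4\<close>. The vertex that is equally far from the ends is
  \<open>3\<close> for the edge \<open>{0, 1}\<close> and \<open>0\<close> for the edge \<open>{2, 3}\<close>.
\<close>

lemma gp_cycle_5_strong_product_le:
  assumes H: "walk_connected H"
  shows "gp (cycle_graph 5 \<boxtimes> H) \<le> 3 * gp H"
proof -
  let ?C = "cycle_graph 5"
  interpret strong_product_factors ?C H
    using walk_connected_cycle_graph[of 5] H by (auto simp: strong_product_factors_def)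
  have one: "hop_dist ?C 0 1 = 1" "hop_dist ?C 1 2 = 1" "hop_dist ?C 2 1 = 1"
      "hop_dist ?C 3 2 = 1" "hop_dist ?C 3 4 = 1" "hop_dist ?C 0 4 = 1"
    by (simp_all add: G.hop_dist_arc arc_cycle_graph)
  have two: "hop_dist ?C 0 2 = 2" "hop_dist ?C 3 1 = 2" "hop_dist ?C 1 4 = 2" "hop_dist ?C 2 4 = 2"
    using G.hop_dist_eq_2I[of 0 1 2] G.hop_dist_eq_2I[of 3 2 1]
      G.hop_dist_eq_2I[of 1 0 4] G.hop_dist_eq_2I[of 2 3 4] by (simp_all add: arc_cycle_graph)
  have V: "v \<in> pverts ?C \<longleftrightarrow> v \<in> {0, 1, 2, 3, 4}" for v by (auto simp: pverts_cycle_graph arc_cycle_graph)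
  show ?thesis
  proof (rule gp_le_blocks[where block = "\<lambda>v. v div 2" and M = "{1, 2}"
        and partner = "\<lambda>v. if v = 1 then 0 else 3" and target = "\<lambda>_. 2"])
    fix v w :: nat assume "v \<in> {1, 2}" "w \<in> pverts ?C" "w div 2 = 2 \<or> w \<in> {1, 2} \<and> (2::nat) = 2"
    then have "v = 1 \<or> v = 2" "w = 1 \<or> w = 2 \<or> w = 4" by (auto simp: V)
    then show "hop_dist ?C v w \<noteq> hop_dist ?C (if v = 1 then 0 else 3) w"
      using one two by (elim disjE) simp_all
  qed (auto simp: V arc_cycle_graph)
qed

lemma gp_cycle_4_ge: "2 \<le> gp (cycle_graph 4)"
proof -
  interpret walk_connected "cycle_graph 4" by (rule walk_connected_cycle_graph) simp
  have "general_position (cycle_graph 4) {0, 1}"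
    by (auto simp: general_position_def pverts_cycle_graph arc_cycle_graph)
  from card_le_gp[OF this] show ?thesis by simp
qed

lemma gp_cycle_5_ge: "3 \<le> gp (cycle_graph 5)"
proof -
  interpret walk_connected "cycle_graph 5" by (rule walk_connected_cycle_graph) simp
  have "hop_dist (cycle_graph 5) 0 1 = 1" "hop_dist (cycle_graph 5) 1 0 = 1"
    by (simp_all add: hop_dist_arc arc_cycle_graph)
  moreover have "hop_dist (cycle_graph 5) 0 3 = 2" "hop_dist (cycle_graph 5) 3 0 = 2"
    by (rule hop_dist_eq_2I[of _ 4]; simp add: arc_cycle_graph)+
  moreover have "hop_dist (cycle_graph 5) 1 3 = 2" "hop_dist (cycle_graph 5) 3 1 = 2"
    by (rule hop_dist_eq_2I[of _ 2]; simp add: arc_cycle_graph)+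
  ultimately have "general_position (cycle_graph 5) {0, 1, 3}"
    unfolding general_position_iff by (auto simp: pverts_cycle_graph)
  from card_le_gp[OF this] show ?thesis by simp
qed

lemma gp_cycle_6_ge: "3 \<le> gp (cycle_graph 6)"
proof -
  let ?C = "cycle_graph 6"
  interpret walk_connected ?C by (rule walk_connected_cycle_graph) simp
  have "hop_dist ?C 0 2 = 2" "hop_dist ?C 2 0 = 2"
    by (rule hop_dist_eq_2I[of _ 1]; simp add: arc_cycle_graph)+
  moreover have "hop_dist ?C 2 4 = 2" "hop_dist ?C 4 2 = 2"
    by (rule hop_dist_eq_2I[of _ 3]; simp add: arc_cycle_graph)+
  moreover have "hop_dist ?C 0 4 = 2" "hop_dist ?C 4 0 = 2"
    by (rule hop_dist_eq_2I[of _ 5]; simp add: arc_cycle_graph)+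
  ultimately have "general_position ?C {0, 2, 4}"
    unfolding general_position_iff by (auto simp: pverts_cycle_graph)
  from card_le_gp[OF this] show ?thesis by simp
qed

lemma le_gp_cycle_strong_product:
  assumes "n \<ge> 3" "walk_connected H" "m \<le> gp (cycle_graph n)"
  shows "m * gp H \<le> gp (cycle_graph n \<boxtimes> H)"
proof -
  interpret strong_product_factors "cycle_graph n" H
    using walk_connected_cycle_graph assms by (simp add: strong_product_factors_def)
  show ?thesis using gp_mult_le mult_le_mono1[OF assms(3)] le_trans by blast
qed

lemma connected_imp_walk_connected:
  assumes "pair_graph H" "Digraph_Component.connected (with_proj H)"
  shows "walk_connected H"
proof -
  interpret pair_graph H by fact
  have "(u, v) \<in> (parcs H)\<^sup>*" if "u \<in> pverts H" "v \<in> pverts H" for u v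
  proof -
    have "u \<rightarrow>\<^sup>*\<^bsub>mk_symmetric (with_proj H)\<^esub> v"
      using assms(2) that by (simp add: connected_def strongly_connected_def)
    then have "u \<rightarrow>\<^sup>*\<^bsub>with_proj H\<^esub> v" using reachable_mk_symmetric_eq sym_arcs by blast
    then show ?thesis using reachable_rtranclI by fastforce
  qed
  then show ?thesis by unfold_locales
qed

theorem theorem3p5:
  fixes H :: "'a pair_pre_digraph"
  assumes "pair_graph H"
    and "Digraph_Component.connected (with_proj H)"
  shows "gp (cycle_graph 4 \<boxtimes> H) = 2 * gp H \<and>
    gp (cycle_graph 5 \<boxtimes> H) = gp (cycle_graph 6 \<boxtimes> H) \<and>
    gp (cycle_graph 6 \<boxtimes> H) = 3 * gp H"
proof -
  have H: "walk_connected H" using assms by (rule connected_imp_walk_connected)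
  have "gp (cycle_graph 4 \<boxtimes> H) = 2 * gp H"
    using gp_even_cycle_strong_product_le[OF _ H, of 2] H
    by (auto intro!: antisym le_gp_cycle_strong_product gp_cycle_4_ge)
  moreover have "gp (cycle_graph 5 \<boxtimes> H) = 3 * gp H"
    using gp_cycle_5_strong_product_le[OF H] H
    by (auto intro!: antisym le_gp_cycle_strong_product gp_cycle_5_ge)
  moreover have "gp (cycle_graph 6 \<boxtimes> H) = 3 * gp H"
    using gp_even_cycle_strong_product_le[OF _ H, of 3] H
    by (auto intro!: antisym le_gp_cycle_strong_product gp_cycle_6_ge)
  ultimately show ?thesis by simp
qed

end
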